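(* Let $\mathbb{F}$ be a field of characteristic $0$ and $\alpha,\lambda\in\mathbb{F}$. Let $\vec d=(d_1,\dots,d_k)$, $k\ge2$, be an odd-symmetric sequence of positive integers, set $d=d_1+\cdots+d_k$, and let $S=(S(1),\dots,S(k-1))$ be a $\phi$-invariant sequence of matrices with $S(i)\in M_{d_i\times d_{i+1}}(\mathbb{F})$ and $S(i)_{d_i,1}\neq0$ for all $i$. Then $$A_{i,d+1-i}=0,\qquad i=1,\dots,\tfrac{d-1}{2},$$ for all $A\in\mathfrak{h}(\alpha,\lambda,S)$. In particular, if in addition $d_1=1$ then $p_{1,k}(\mathfrak{h}(\alpha,\lambda,S))=0$.
   Context: Matrices in $\mathfrak{gl}(d)=\mathfrak{gl}(d,\mathbb{F})$ are partitioned into blocks according to $\vec d$; $p_{i,j}:\mathfrak{gl}(d)\to M_{d_i\times d_j}$ is the projection onto the $(i,j)$ block. $\vec d$ is odd-symmetric if $d_i=d_{k+1-i}$ for all $i$, $k$ is odd and $d_{(k+1)/2}$ is odd. $J^p(\beta)$ is the upper triangular Jordan block of size $p$ and eigenvalue $\beta$. $D(\alpha,\lambda)=J^{d_1}(\alpha)\oplus J^{d_2}(\alpha-\lambda)\oplus\cdots\oplus J^{d_k}(\alpha-(k-1)\lambda)$. $E(S)\in\mathfrak{gl}(d)$ is the block matrix whose $(i,i+1)$ block is $S(i)$, $1\le i\le k-1$, and all of whose other blocks are $0$. $\mathfrak{h}(\alpha,\lambda,S)$ is the Lie subalgebra of $\mathfrak{gl}(d)$ generated by $D(\alpha,\lambda)$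 and $E(S)$. $S$ is $\phi$-invariant if $\phi(E(S))=E(S)$, where $\phi:\mathfrak{gl}(d)\to\mathfrak{gl}(d)$ is the automorphism $\phi(A)_{i,j}=(-1)^{i-j+1}A_{d+1-j,d+1-i}$. *)

theory Defs
  imports "Jordan_Normal_Form.Jordan_Normal_Form"
begin

text \<open>All indices are 0-based: the mathematical index \<open>i\<close> corresponds to \<open>i - 1\<close> here. A sequence
  \<open>ds\<close> of block sizes has length \<open>k\<close>, and \<open>gl(d)\<close> is \<open>carrier_mat d d\<close> with \<open>d = sum_list ds\<close>.\<close>

definition block_offset :: "nat list \<Rightarrow> nat \<Rightarrow> nat" where
  "block_offset ds i = sum_list (take i ds)"

definition block_proj :: "nat list \<Rightarrow> nat \<Rightarrow> nat \<Rightarrow> 'a mat \<Rightarrow> 'a mat" where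
  "block_proj ds i j A =
     mat (ds ! i) (ds ! j) (\<lambda>(a, b). A $$ (block_offset ds i + a, block_offset ds j + b))"

text \<open>The number of the block containing the row (or column) index \<open>r\<close>.\<close>

definition block_of :: "nat list \<Rightarrow> nat \<Rightarrow> nat" where
  "block_of ds r = (LEAST i. r < block_offset ds (Suc i))"

definition mat_of_blocks :: "nat list \<Rightarrow> (nat \<Rightarrow> nat \<Rightarrow> 'a mat) \<Rightarrow> 'a mat" where
  "mat_of_blocks ds B = mat (sum_list ds) (sum_list ds) (\<lambda>(r, c).
     let i = block_of ds r; j = block_of ds c
     in B i j $$ (r - block_offset ds i, c - block_offset ds j))"

definition odd_symmetric :: "nat list \<Rightarrow> bool" where
  "odd_symmetric ds \<longleftrightarrow>
     (\<forall>i < length ds. ds ! i = ds ! (length ds - 1 - i)) \<and>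
     odd (length ds) \<and> odd (ds ! ((length ds - 1) div 2))"

definition D_mat :: "nat list \<Rightarrow> 'a::field \<Rightarrow> 'a \<Rightarrow> 'a mat" where
  "D_mat ds \<alpha> \<mu> =
     jordan_matrix (map (\<lambda>i. (ds ! i, \<alpha> - of_nat i * \<mu>)) [0..<length ds])"

definition E_mat :: "nat list \<Rightarrow> 'a::field mat list \<Rightarrow> 'a mat" where
  "E_mat ds S = mat_of_blocks ds (\<lambda>i j. if j = Suc i then S ! i else 0\<^sub>m (ds ! i) (ds ! j))"

definition lie_bracket :: "'a::field mat \<Rightarrow> 'a mat \<Rightarrow> 'a mat" where
  "lie_bracket A B = A * B - B * A"

definition lie_subalgebra :: "nat \<Rightarrow> 'a::field mat set \<Rightarrow> bool" where
  "lie_subalgebra d H \<longleftrightarrow>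
     H \<subseteq> carrier_mat d d \<and> 0\<^sub>m d d \<in> H \<and>
     (\<forall>A\<in>H. \<forall>B\<in>H. A + B \<in> H) \<and>
     (\<forall>c. \<forall>A\<in>H. c \<cdot>\<^sub>m A \<in> H) \<and>
     (\<forall>A\<in>H. \<forall>B\<in>H. lie_bracket A B \<in> H)"

definition lie_generated :: "nat \<Rightarrow> 'a::field mat set \<Rightarrow> 'a mat set" where
  "lie_generated d X = \<Inter>{H. lie_subalgebra d H \<and> X \<subseteq> H}"

definition h_alg :: "nat list \<Rightarrow> 'a::field \<Rightarrow> 'a \<Rightarrow> 'a mat list \<Rightarrow> 'a mat set" where
  "h_alg ds \<alpha> \<mu> S = lie_generated (sum_list ds) {D_mat ds \<alpha> \<mu>, E_mat ds S}"

text \<open>The sign exponent may be negative, hence the integer power.\<close>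

definition phi :: "nat \<Rightarrow> 'a::field mat \<Rightarrow> 'a mat" where
  "phi d A = mat d d (\<lambda>(i, j).
     (-1) powi (int i - int j + 1) * A $$ (d - 1 - j, d - 1 - i))"

definition phi_invariant :: "nat list \<Rightarrow> 'a::field mat list \<Rightarrow> bool" where
  "phi_invariant ds S \<longleftrightarrow> phi (sum_list ds) (E_mat ds S) = E_mat ds S"

lemma block_offset_mono: "i \<le> j \<Longrightarrow> block_offset ds i \<le> block_offset ds j"
proof -
  assume "i \<le> j"
  then obtain n where j: "j = i + n" using le_Suc_ex by blast
  show ?thesis by (simp add: block_offset_def j take_add)
qed

lemma block_offset_Suc: "i < length ds \<Longrightarrow> block_offset ds (Suc i) = block_offset ds i + ds ! i"
  by (simp add: block_offset_def take_Suc_conv_app_nth)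

lemma block_of_offset:
  assumes "i < length ds" "a < ds ! i"
  shows "block_of ds (block_offset ds i + a) = i"
  unfolding block_of_def
proof (rule Least_equality)
  show "block_offset ds i + a < block_offset ds (Suc i)"
    using assms by (simp add: block_offset_Suc)
next
  fix j assume *: "block_offset ds i + a < block_offset ds (Suc j)"
  show "i \<le> j"
  proof (rule ccontr)
    assume "\<not> i \<le> j"
    then have "block_offset ds (Suc j) \<le> block_offset ds i" by (intro block_offset_mono) simp
    with * show False by simp
  qed
qed

lemma block_offset_less:
  assumes "i < length ds" "a < ds ! i"
  shows "block_offset ds i + a < sum_list ds"
  using assms block_offset_Suc[of i ds] block_offset_mono[of "Suc i" "length ds" ds]
  by (simp add: block_offset_def)

lemma block_proj_mat_of_blocks:
  assumes "i < length ds" "j < length ds" "B i j \<in> carrier_mat (ds ! i) (ds ! j)"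
  shows "block_proj ds i j (mat_of_blocks ds B) = B i j"
  using assms
  by (intro eq_matI) (auto simp: block_proj_def mat_of_blocks_def block_of_offset block_offset_less)

lemma block_proj_E_mat:
  assumes "i < length ds" "j < length ds"
    and "\<And>i. Suc i < length ds \<Longrightarrow> S ! i \<in> carrier_mat (ds ! i) (ds ! Suc i)"
  shows "block_proj ds i j (E_mat ds S) = (if j = Suc i then S ! i else 0\<^sub>m (ds ! i) (ds ! j))"
  unfolding E_mat_def by (subst block_proj_mat_of_blocks) (use assms in auto)

end

theory Submission
  imports Defs
begin

text \<open>The map \<open>phi\<close> is a Lie algebra automorphism, so the matrices \<open>A\<close> for which \<open>phi A - A\<close> is scalar
  form a Lie subalgebra. It contains \<open>E(S)\<close> by hypothesis, and it contains \<open>D\<close> because reflecting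
  in the antidiagonal reverses the order of the Jordan blocks, which for a symmetric sequence of
  sizes only shifts the arithmetic progression of negated eigenvalues. As \<open>d\<close> is odd, \<open>phi\<close> negates
  every antidiagonal entry, while a scalar matrix contributes to the central one only.\<close>

section \<open>The Lie algebra automorphism \<open>phi\<close>\<close>

lemma minus_one_powi: "(-1) powi n = (if even n then 1 else -1 :: 'a::field)"
  by (auto simp: power_int_def even_nat_iff)

lemma phi_carrier [simp]: "phi d A \<in> carrier_mat d d"
  by (simp add: phi_def)

lemma phi_dim [simp]: "dim_row (phi d A) = d" "dim_col (phi d A) = d"
  by (simp_all add: phi_def)

text \<open>The exponent \<open>i - j + 1\<close> has parity opposite to \<open>i + j\<close>, so
  the sign can be read off from natural numbers, without integer powers.\<close>

lemma phi_index:
  assumes "i < d" "j < d"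
  shows "phi d A $$ (i, j) = (if even (i + j) then -1 else 1) * A $$ (d - 1 - j, d - 1 - i)"
  using assms by (simp add: phi_def minus_one_powi)

lemma phi_add:
  assumes "A \<in> carrier_mat d d" "B \<in> carrier_mat d d"
  shows "phi d (A + B) = phi d A + phi d B"
  using assms by (intro eq_matI) (auto simp: phi_index)

lemma phi_minus:
  assumes "A \<in> carrier_mat d d" "B \<in> carrier_mat d d"
  shows "phi d (A - B) = phi d A - phi d B"
  using assms by (intro eq_matI) (auto simp: phi_index)

lemma phi_smult:
  assumes "A \<in> carrier_mat d d"
  shows "phi d (c \<cdot>\<^sub>m A) = c \<cdot>\<^sub>m phi d A"
  using assms by (intro eq_matI) (auto simp: phi_index)

text \<open>Reflection in the antidiagonal reverses products, like transposition. The signs at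
  \<open>(i, l)\<close> and \<open>(l, j)\<close> multiply to \<open>(-1)^(i + j)\<close>,
  independently of \<open>l\<close>, and this is the negative of the sign at
  \<open>(i, j)\<close>.\<close>

lemma phi_mult:
  assumes A: "A \<in> carrier_mat d d" and B: "B \<in> carrier_mat d d"
  shows "phi d (A * B) = - (phi d B * phi d A)"
proof (rule eq_matI)
  fix i j assume "i < dim_row (- (phi d B * phi d A))" "j < dim_col (- (phi d B * phi d A))"
  then have ij: "i < d" "j < d" by auto
  let ?s = "\<lambda>a b :: nat. (if even (a + b) then -1 else 1 :: 'a)"
  have "(phi d B * phi d A) $$ (i, j) = (\<Sum>l<d. phi d B $$ (i, l) * phi d A $$ (l, j))"
    using ij by (simp add: scalar_prod_def atLeast0LessThan)
  also have "\<dots> = (\<Sum>l<d. - (?s i j * (A $$ (d - 1 - j, d - 1 - l) * B $$ (d - 1 - l, d - 1 - i))))"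
    by (rule sum.cong) (use ij in \<open>auto simp: phi_index\<close>)
  \<comment> \<open>The reflection turns the summation index around; the involution
    \<open>d - 1 - l\<close> of the index range undoes this.\<close>
  also have "\<dots> = (\<Sum>l<d. - (?s i j * (A $$ (d - 1 - j, l) * B $$ (l, d - 1 - i))))"
    by (rule sum.reindex_bij_witness[of _ "\<lambda>l. d - 1 - l" "\<lambda>l. d - 1 - l"]) auto
  also have "\<dots> = - (?s i j * (\<Sum>l<d. A $$ (d - 1 - j, l) * B $$ (l, d - 1 - i)))"
    by (simp add: sum_negf sum_distrib_left)
  also have "(\<Sum>l<d. A $$ (d - 1 - j, l) * B $$ (l, d - 1 - i)) = (A * B) $$ (d - 1 - j, d - 1 - i)"
    using ij A B by (simp add: scalar_prod_def atLeast0LessThan)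
  finally show "phi d (A * B) $$ (i, j) = (- (phi d B * phi d A)) $$ (i, j)"
    using ij by (simp add: phi_index)
qed auto

text \<open>The minus sign and the reversal of factors in \<open>phi_mult\<close> compensate each
  other in a commutator.\<close>

lemma phi_lie_bracket:
  assumes A: "A \<in> carrier_mat d d" and B: "B \<in> carrier_mat d d"
  shows "phi d (lie_bracket A B) = lie_bracket (phi d A) (phi d B)"
proof -
  have "phi d (lie_bracket A B) = - (phi d B * phi d A) - - (phi d A * phi d B)"
    using A B by (simp add: lie_bracket_def phi_minus[of _ d] phi_mult)
  also have "\<dots> = lie_bracket (phi d A) (phi d B)"
    by (rule eq_matI) (auto simp: lie_bracket_def)
  finally show ?thesis .
qed

section \<open>Matrices fixed by \<open>phi\<close> up to a scalar matrix\<close>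

lemma lie_bracket_add_scalar:
  assumes A: "A \<in> carrier_mat d d" and B: "B \<in> carrier_mat d d"
  shows "lie_bracket (A + a \<cdot>\<^sub>m 1\<^sub>m d) (B + b \<cdot>\<^sub>m 1\<^sub>m d) = lie_bracket A B"
proof -
  \<comment> \<open>Apart from \<open>X * Y\<close>, the right-hand side is symmetric in the two
    factors, so these terms cancel in the bracket.\<close>
  have eq: "(X + x \<cdot>\<^sub>m 1\<^sub>m d) * (Y + y \<cdot>\<^sub>m 1\<^sub>m d) = X * Y + x \<cdot>\<^sub>m Y + (y \<cdot>\<^sub>m X + (x * y) \<cdot>\<^sub>m 1\<^sub>m d)"
    if X: "X \<in> carrier_mat d d" and Y: "Y \<in> carrier_mat d d" for X Y and x y :: 'a
  proof -
    have "(X + x \<cdot>\<^sub>m 1\<^sub>m d) * (Y + y \<cdot>\<^sub>m 1\<^sub>m d)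
        = (X + x \<cdot>\<^sub>m 1\<^sub>m d) * Y + (X + x \<cdot>\<^sub>m 1\<^sub>m d) * (y \<cdot>\<^sub>m 1\<^sub>m d)"
      by (rule mult_add_distrib_mat[of _ d d _ d]) (use X Y in auto)
    also have "(X + x \<cdot>\<^sub>m 1\<^sub>m d) * Y = X * Y + x \<cdot>\<^sub>m Y"
      using X Y by (simp add: add_mult_distrib_mat[of _ d d _ _ d] mult_smult_assoc_mat[of _ d d _ d])
    also have "(X + x \<cdot>\<^sub>m 1\<^sub>m d) * (y \<cdot>\<^sub>m 1\<^sub>m d) = y \<cdot>\<^sub>m X + (x * y) \<cdot>\<^sub>m 1\<^sub>m d"
      using X by (intro eq_matI) (auto simp: algebra_simps)
    finally show ?thesis .
  qed
  show ?thesis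
    unfolding lie_bracket_def eq[OF A B] eq[OF B A]
    by (rule eq_matI) (use A B in auto)
qed

text \<open>The scalar defect \<open>c\<close> depends linearly on the matrix. On brackets it is 0,
  since scalar matrices are central.\<close>

lemma lie_subalgebra_phi_eq_add_scalar:
  "lie_subalgebra d {A \<in> carrier_mat d d. \<exists>c. phi d A = A + c \<cdot>\<^sub>m 1\<^sub>m d}" (is "lie_subalgebra d ?H")
proof -
  have "phi d (0\<^sub>m d d) = (0\<^sub>m d d :: 'a mat) + 0 \<cdot>\<^sub>m 1\<^sub>m d"
    by (rule eq_matI) (auto simp: phi_index)
  then have zero: "0\<^sub>m d d \<in> ?H" by auto
  have add: "A + B \<in> ?H" if "A \<in> ?H" "B \<in> ?H" for A B
  proof -
    from that obtain a b where AB: "A \<in> carrier_mat d d" "B \<in> carrier_mat d d"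
      "phi d A = A + a \<cdot>\<^sub>m 1\<^sub>m d" "phi d B = B + b \<cdot>\<^sub>m 1\<^sub>m d" by auto
    then have "phi d (A + B) = (A + B) + (a + b) \<cdot>\<^sub>m 1\<^sub>m d"
      unfolding phi_add[OF AB(1,2)] AB(3,4) by (intro eq_matI) (auto simp: algebra_simps)
    with AB show ?thesis by auto
  qed
  have smult: "c \<cdot>\<^sub>m A \<in> ?H" if "A \<in> ?H" for A c
  proof -
    from that obtain a where A: "A \<in> carrier_mat d d" "phi d A = A + a \<cdot>\<^sub>m 1\<^sub>m d" by auto
    then have "phi d (c \<cdot>\<^sub>m A) = c \<cdot>\<^sub>m A + (c * a) \<cdot>\<^sub>m 1\<^sub>m d"
      unfolding phi_smult[OF A(1)] A(2) by (intro eq_matI) (auto simp: algebra_simps)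
    with A show ?thesis by auto
  qed
  have bracket: "lie_bracket A B \<in> ?H" if "A \<in> ?H" "B \<in> ?H" for A B
  proof -
    from that obtain a b where AB: "A \<in> carrier_mat d d" "B \<in> carrier_mat d d"
      "phi d A = A + a \<cdot>\<^sub>m 1\<^sub>m d" "phi d B = B + b \<cdot>\<^sub>m 1\<^sub>m d" by auto
    then have carrier: "lie_bracket A B \<in> carrier_mat d d"
      by (simp add: lie_bracket_def minus_carrier_mat)
    have "phi d (lie_bracket A B) = lie_bracket A B"
      unfolding phi_lie_bracket[OF AB(1,2)] AB(3,4) by (rule lie_bracket_add_scalar[OF AB(1,2)])
    also have "\<dots> = lie_bracket A B + 0 \<cdot>\<^sub>m 1\<^sub>m d"
      using carrier by (intro eq_matI) auto
    finally show ?thesis using carrier by auto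
  qed
  show ?thesis
    unfolding lie_subalgebra_def using zero add smult bracket by blast
qed

section \<open>Reflection of Jordan matrices\<close>

lemma phi_four_block_diag:
  assumes A: "A \<in> carrier_mat n n" and B: "B \<in> carrier_mat m m"
  shows "phi (n + m) (four_block_mat A (0\<^sub>m n m) (0\<^sub>m m n) B)
       = four_block_mat (phi m B) (0\<^sub>m m n) (0\<^sub>m n m) (phi n A)"
proof (rule eq_matI)
  fix i j
  assume "i < dim_row (four_block_mat (phi m B) (0\<^sub>m m n) (0\<^sub>m n m) (phi n A))"
    and "j < dim_col (four_block_mat (phi m B) (0\<^sub>m m n) (0\<^sub>m n m) (phi n A))"
  then have ij: "i < n + m" "j < n + m" by auto
  \<comment> \<open>Inside the second diagonal block both indices are shifted by \<open>m\<close>,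
    which leaves the sign unchanged.\<close>
  have parity: "even (i - m + (j - m)) \<longleftrightarrow> even (i + j)" if "\<not> i < m" "\<not> j < m"
    using that by presburger
  have reflect: "n + m - 1 - l - n = m - 1 - l" "\<not> n + m - 1 - l < n" if "l < m" for l
    using that by auto
  have reflect': "n + m - 1 - l = n - 1 - (l - m)" "n - 1 - (l - m) < n" if "l < n + m" "\<not> l < m" for l
    using that by auto
  show "phi (n + m) (four_block_mat A (0\<^sub>m n m) (0\<^sub>m m n) B) $$ (i, j)
      = four_block_mat (phi m B) (0\<^sub>m m n) (0\<^sub>m n m) (phi n A) $$ (i, j)"
    using ij A B parity
    by (cases "i < m"; cases "j < m") (auto simp: phi_index reflect reflect')
qed auto

text \<open>The sign is -1 on the diagonal and +1 on the superdiagonal, and the reflection preserves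
  both diagonals.\<close>

lemma phi_jordan_block: "phi n (jordan_block n a) = jordan_block n (- a)"
  by (rule eq_matI) (auto simp: phi_index)

lemma phi_jordan_matrix:
  "phi (sum_list (map fst n_as)) (jordan_matrix n_as)
    = jordan_matrix (rev (map (\<lambda>(n, a). (n, - a)) n_as))"
proof (induction n_as)
  case Nil
  show ?case by (rule eq_matI) (auto simp: jordan_matrix_def)
next
  case (Cons na n_as)
  obtain n a where na: "na = (n, a)" by force
  let ?m = "sum_list (map fst n_as)"
  \<comment> \<open>Reversing the blocks and negating eigenvalues keeps the total size, so the zero
    blocks below have matching dimensions.\<close>
  have dim: "sum_list (map fst (rev (map (\<lambda>(n, a). (n, - a)) n_as))) = ?m"
    by (simp add: comp_def case_prod_beta' rev_map[symmetric])
  have "jordan_matrix (na # n_as)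
      = four_block_mat (jordan_block n a) (0\<^sub>m n ?m) (0\<^sub>m ?m n) (jordan_matrix n_as)"
    using jordan_matrix_dim[of n_as] by (simp add: na jordan_matrix_def Let_def)
  then have "phi (n + ?m) (jordan_matrix (na # n_as))
      = four_block_mat (jordan_matrix (rev (map (\<lambda>(n, a). (n, - a)) n_as)))
          (0\<^sub>m ?m n) (0\<^sub>m n ?m) (jordan_block n (- a))"
    by (simp add: phi_four_block_diag phi_jordan_block Cons.IH)
  also have "\<dots> = jordan_matrix (rev (map (\<lambda>(n, a). (n, - a)) n_as) @ [(n, - a)])"
    using jordan_matrix_dim[of "rev (map (\<lambda>(n, a). (n, - a)) n_as)", unfolded dim]
    by (simp add: jordan_matrix_def diag_block_mat_last Let_def)
  finally show ?case by (simp add: na)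
qed

lemma jordan_matrix_add_scalar:
  fixes c :: "'a::field"
  shows "jordan_matrix (map (\<lambda>(n, a). (n, a + c)) n_as)
    = jordan_matrix n_as + c \<cdot>\<^sub>m 1\<^sub>m (sum_list (map fst n_as))"
proof (induction n_as)
  case Nil
  show ?case by (rule eq_matI) (auto simp: jordan_matrix_def)
next
  case (Cons na n_as)
  obtain n a where na: "na = (n, a)" by force
  let ?m = "sum_list (map fst n_as)"
  have Cons_eq: "jordan_matrix ((n, x) # xs)
      = four_block_mat (jordan_block n x) (0\<^sub>m n ?m) (0\<^sub>m ?m n) (jordan_matrix xs)"
    if "sum_list (map fst xs) = ?m" for x :: 'a and xs
    using that jordan_matrix_dim[of xs] by (simp add: jordan_matrix_def Let_def)
  have dim: "sum_list (map fst (map (\<lambda>(n, a). (n, a + c)) n_as)) = ?m"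
    by (simp add: comp_def case_prod_beta')
  have "jordan_matrix ((n, a + c) # map (\<lambda>(n, a). (n, a + c)) n_as)
      = jordan_matrix ((n, a) # n_as) + c \<cdot>\<^sub>m 1\<^sub>m (n + ?m)"
    unfolding Cons_eq[OF dim] Cons_eq[OF refl] Cons.IH by (rule eq_matI) auto
  then show ?case by (simp add: na)
qed

section \<open>Odd-symmetric sequences and the generator \<open>D_mat\<close>\<close>

lemma odd_symmetric_rev:
  assumes "odd_symmetric ds"
  shows "rev ds = ds"
proof (rule nth_equalityI)
  fix i assume "i < length (rev ds)"
  then have i: "i < length ds" by simp
  then have "ds ! i = ds ! (length ds - 1 - i)"
    using assms unfolding odd_symmetric_def by blast
  then show "rev ds ! i = ds ! i"
    using i by (simp add: rev_nth)
qed simp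

text \<open>The entries on either side of the odd middle one have equal sums.\<close>

lemma odd_sum_list_odd_symmetric:
  assumes "odd_symmetric ds"
  shows "odd (sum_list ds)"
proof -
  from assms obtain m where "length ds = 2 * m + 1"
    unfolding odd_symmetric_def by (blast elim: oddE)
  moreover from this have "(length ds - 1) div 2 = m" by simp
  ultimately have m: "length ds = 2 * m + 1" and mid: "odd (ds ! m)"
    using assms unfolding odd_symmetric_def by metis+
  have "drop (Suc m) ds = rev (take m (rev ds))"
    unfolding take_rev rev_rev_ident m by (simp add: Suc_diff_le mult_2)
  then have drop: "drop (Suc m) ds = rev (take m ds)"
    by (simp add: odd_symmetric_rev[OF assms])
  have "sum_list ds = sum_list (take m ds @ ds ! m # drop (Suc m) ds)"
    using m by (simp add: id_take_nth_drop[symmetric])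
  also have "\<dots> = 2 * sum_list (take m ds) + ds ! m"
    unfolding drop by (simp add: sum_list_rev)
  finally show ?thesis using mid by simp
qed

lemma D_mat_carrier: "D_mat ds \<alpha> \<mu> \<in> carrier_mat (sum_list ds) (sum_list ds)"
proof -
  have "map fst (map (\<lambda>i. (ds ! i, \<alpha> - of_nat i * \<mu>)) [0..<length ds]) = ds"
    by (simp add: comp_def map_nth)
  then show ?thesis unfolding D_mat_def by (metis jordan_matrix_carrier)
qed

text \<open>With \<open>k\<close> blocks, position \<open>i\<close> receives the eigenvalue
  \<open>-(\<alpha> - (k - 1 - i) * \<mu>)\<close>, which exceeds the old one,
  \<open>\<alpha> - i * \<mu>\<close>, by \<open>(k - 1) * \<mu> - 2 * \<alpha>\<close> for every
  \<open>i\<close>. Block sizes are unchanged because the sequence is a palindrome.\<close>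

lemma phi_D_mat:
  assumes "odd_symmetric ds"
  shows "phi (sum_list ds) (D_mat ds \<alpha> \<mu>)
    = D_mat ds \<alpha> \<mu> + (of_nat (length ds - 1) * \<mu> - 2 * \<alpha>) \<cdot>\<^sub>m 1\<^sub>m (sum_list ds)"
proof -
  let ?n_as = "map (\<lambda>i. (ds ! i, \<alpha> - of_nat i * \<mu>)) [0..<length ds]"
  let ?c = "of_nat (length ds - 1) * \<mu> - 2 * \<alpha>"
  have fst: "map fst ?n_as = ds" by (simp add: comp_def map_nth)
  have "rev (map (\<lambda>(n, a). (n, - a)) ?n_as) = map (\<lambda>(n, a). (n, a + ?c)) ?n_as"
  proof (rule nth_equalityI)
    fix i assume "i < length (rev (map (\<lambda>(n, a). (n, - a)) ?n_as))"
    then have i: "i < length ds" by simp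
    have size: "ds ! (length ds - Suc i) = ds ! i"
      using arg_cong[OF odd_symmetric_rev[OF assms], of "\<lambda>xs. xs ! i"] i by (simp add: rev_nth)
    have "of_nat (length ds - Suc i) = (of_nat (length ds - 1) - of_nat i :: 'a)"
      using i by (subst of_nat_diff[symmetric]) auto
    then have "- (\<alpha> - of_nat (length ds - Suc i) * \<mu>) = \<alpha> - of_nat i * \<mu> + ?c"
      by (simp only:) (simp add: left_diff_distrib)
    then show "rev (map (\<lambda>(n, a). (n, - a)) ?n_as) ! i
        = map (\<lambda>(n, a). (n, a + ?c)) ?n_as ! i"
      using i size by (simp add: rev_nth del: of_nat_diff)
  qed simp
  then show ?thesis
    using phi_jordan_matrix[of ?n_as] jordan_matrix_add_scalar[of ?c ?n_as]
    unfolding fst D_mat_def by simp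
qed

section \<open>Vanishing on the antidiagonal\<close>

lemma antidiagonal_eq_0:
  fixes A :: "'a::field_char_0 mat"
  assumes "odd d" "A \<in> carrier_mat d d" "phi d A = A + c \<cdot>\<^sub>m 1\<^sub>m d" "i < (d - 1) div 2"
  shows "A $$ (i, d - 1 - i) = 0"
proof -
  have i: "i < d" "d - 1 - i < d" "i \<noteq> d - 1 - i" using assms(4) by auto
  \<comment> \<open>The position is its own mirror image and its indices add up to
    \<open>d - 1\<close>, which is even: the entry changes sign under \<open>phi\<close>. Lying off
    the main diagonal, it is not affected by the scalar term, so it equals its own negative, and
    characteristic 0 makes it vanish.\<close>
  have "even (i + (d - 1 - i))" using assms(1) i by simp
  then have "- A $$ (i, d - 1 - i) = phi d A $$ (i, d - 1 - i)"
    using i by (simp add: phi_index)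
  also have "\<dots> = A $$ (i, d - 1 - i)"
    using i assms(2) by (simp add: assms(3))
  finally show ?thesis by simp
qed

theorem proposition3p2:
  fixes \<alpha> \<mu> :: "'a::field_char_0"
    and ds :: "nat list"
    and S :: "'a mat list"
    and k d :: nat
  assumes "k = length ds" and "d = sum_list ds"
    and "k \<ge> 2"
    and "\<And>i. i < k \<Longrightarrow> ds ! i > 0"
    and "odd_symmetric ds"
    and "length S = k - 1"
    and "\<And>i. i < k - 1 \<Longrightarrow> S ! i \<in> carrier_mat (ds ! i) (ds ! Suc i)"
    and "phi_invariant ds S"
    and "\<And>i. i < k - 1 \<Longrightarrow> (S ! i) $$ (ds ! i - 1, 0) \<noteq> 0"
  shows "(\<forall>A \<in> h_alg ds \<alpha> \<mu> S. \<forall>i < (d - 1) div 2. A $$ (i, d - 1 - i) = 0) \<and>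
         (ds ! 0 = 1 \<longrightarrow>
            block_proj ds 0 (k - 1) ` h_alg ds \<alpha> \<mu> S = {0\<^sub>m (ds ! 0) (ds ! (k - 1))})"
proof -
  let ?H = "{A \<in> carrier_mat d d. \<exists>c. phi d A = A + c \<cdot>\<^sub>m 1\<^sub>m d} :: 'a mat set"
  have "E_mat ds S \<in> carrier_mat d d"
    by (simp add: E_mat_def mat_of_blocks_def assms(2))
  moreover from this have "phi d (E_mat ds S) = E_mat ds S + 0 \<cdot>\<^sub>m 1\<^sub>m d"
    using assms(8) by (intro eq_matI) (auto simp: phi_invariant_def assms(2))
  ultimately have "{D_mat ds \<alpha> \<mu>, E_mat ds S} \<subseteq> ?H"
    using D_mat_carrier[of ds \<alpha> \<mu>] phi_D_mat[OF assms(5), of \<alpha> \<mu>] by (auto simp: assms(2))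
  then have sub: "h_alg ds \<alpha> \<mu> S \<subseteq> ?H"
    unfolding h_alg_def lie_generated_def assms(2)[symmetric]
    using lie_subalgebra_phi_eq_add_scalar by blast
  have "odd d" using odd_sum_list_odd_symmetric[OF assms(5)] by (simp add: assms(2))
  then have anti: "A $$ (i, d - 1 - i) = 0" if "A \<in> h_alg ds \<alpha> \<mu> S" "i < (d - 1) div 2" for A i
    using antidiagonal_eq_0 that sub by blast
  have "block_proj ds 0 (k - 1) ` h_alg ds \<alpha> \<mu> S = {0\<^sub>m (ds ! 0) (ds ! (k - 1))}" if d0: "ds ! 0 = 1"
  proof -
    have last: "ds ! (k - 1) = 1"
      using assms(1,3,5) d0 by (force simp: odd_symmetric_def)
    \<comment> \<open>Positive block sizes give \<open>d \<ge> k\<close>, and an odd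
      \<open>k \<ge> 2\<close> is at least 3. Hence \<open>0 < (d - 1) div 2\<close>, so that
      \<open>anti\<close> covers the corner entry \<open>(0, d - 1)\<close>.\<close>
    have "length ds * 1 \<le> sum_list ds"
      using sum_list_mono[of ds "\<lambda>_. 1" id] assms(1,4)
      by (auto simp: in_set_conv_nth sum_list_triv Suc_le_eq)
    moreover have "odd k" using assms(1,5) by (simp add: odd_symmetric_def)
    ultimately have "d \<ge> 3"
      using assms(1,2,3) by (cases "k = 2") auto
    \<comment> \<open>The last block has size 1 and therefore starts at \<open>d - 1\<close>: the
      block in question consists of the corner entry alone.\<close>
    have "d = block_offset ds (Suc (k - 1))"
      using assms(1-3) by (simp add: block_offset_def)
    then have offset: "block_offset ds (k - 1) = d - 1"
      using block_offset_Suc[of "k - 1" ds] assms(1,3) last by simp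
    have "block_proj ds 0 (k - 1) A = 0\<^sub>m (ds ! 0) (ds ! (k - 1))" if "A \<in> h_alg ds \<alpha> \<mu> S" for A
      using anti[OF that, of 0] \<open>d \<ge> 3\<close>
      by (intro eq_matI) (auto simp: block_proj_def d0 last offset block_offset_def[of ds 0] simp del: One_nat_def)
    \<comment> \<open>The image equals the singleton only if the algebra is nonempty.\<close>
    moreover have "0\<^sub>m d d \<in> h_alg ds \<alpha> \<mu> S"
      by (auto simp: h_alg_def lie_generated_def lie_subalgebra_def assms(2))
    ultimately show ?thesis by (auto simp: image_iff)
  qed
  with anti show ?thesis by blast
qed

end
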